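(* For every integer $k\ge 2$ and every integer $r\ge 3$, \[ \operatorname{ssat}_r(K_k)\le 8k^3r^3. \]
   Context: For an integer $r\ge 2$, let $\mathcal{G}_r$ denote the family of (finite) complete graphs whose edges are colored with $r$ colors $1,2,\dots,r$ (arbitrary, not necessarily proper, edge-colorings). For $G,G'\in\mathcal{G}_r$, $G'$ extends $G$ if $G'$ can be obtained from $G$ by iteratively adding a new vertex together with colored edges joining the new vertex to all existing vertices (at least one new vertex is added). A graph $G\in\mathcal{G}_r$ is $(r,K_k)$-semisaturated if every $G'\in\mathcal{G}_r$ that extends $G$ contains a new monochromatic $K_k$, i.e. a copy of $K_k$ with all edges of the same color that is not contained in $G$ (so it uses at least one new vertex); $G$ itself is allowed to contain monochromatic copies of $K_k$. Define \[ \operatorname{ssat}_r(K_k):=\min\{|V(G)| : G\in\mathcal{G}_r \text{ is } (r,K_k)\text{-semisaturated}\}. \] *)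

theory Defs
  imports Main "HOL-Library.Ramsey" "HOL-Library.Extended_Nat"
begin

text \<open>A complete graph with colored edges is given by its vertex set and a color for every
  two-element set of vertices.  Only the colors of sets in \<open>nsets (verts G) 2\<close> matter.
  Vertices are natural numbers, so every finite graph occurs up to isomorphism and fresh
  vertices are always available.\<close>

record cgraph =
  verts :: "nat set"
  color :: "nat set \<Rightarrow> nat"

definition edges :: "cgraph \<Rightarrow> nat set set" where
  "edges G = nsets (verts G) 2"

definition colored_complete_graphs :: "nat \<Rightarrow> cgraph set" where
  "colored_complete_graphs r = {G. finite (verts G) \<and> color G ` edges G \<subseteq> {1..r}}"

definition adds_vertex :: "nat \<Rightarrow> cgraph \<Rightarrow> cgraph \<Rightarrow> bool" where
  "adds_vertex r G G' \<longleftrightarrow>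
     G \<in> colored_complete_graphs r \<and> G' \<in> colored_complete_graphs r \<and>
     (\<exists>v. v \<notin> verts G \<and> verts G' = insert v (verts G)) \<and>
     (\<forall>e\<in>edges G. color G' e = color G e)"

definition extends :: "nat \<Rightarrow> cgraph \<Rightarrow> cgraph \<Rightarrow> bool" where
  "extends r G' G \<longleftrightarrow> (adds_vertex r)\<^sup>+\<^sup>+ G G'"

text \<open>\<open>S\<close> is the vertex set of a monochromatic \<open>K\<^sub>k\<close> in \<open>G\<close>.\<close>

definition mono_clique :: "nat \<Rightarrow> cgraph \<Rightarrow> nat set \<Rightarrow> bool" where
  "mono_clique k G S \<longleftrightarrow> S \<in> nsets (verts G) k \<and> (\<exists>i. \<forall>e\<in>nsets S 2. color G e = i)"

definition semisaturated :: "nat \<Rightarrow> nat \<Rightarrow> cgraph \<Rightarrow> bool" where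
  "semisaturated r k G \<longleftrightarrow>
     G \<in> colored_complete_graphs r \<and>
     (\<forall>G'\<in>colored_complete_graphs r. extends r G' G \<longrightarrow>
        (\<exists>S. mono_clique k G' S \<and> \<not> S \<subseteq> verts G))"

text \<open>The minimum is taken in \<^typ>\<open>enat\<close>: it would be \<open>\<infinity>\<close> if there were no semisaturated graph,
  so that an upper bound on it also asserts existence (see \<open>ssat_le_iff\<close>).\<close>

definition ssat :: "nat \<Rightarrow> nat \<Rightarrow> enat" where
  "ssat r k = (INF G\<in>{G. semisaturated r k G}. enat (card (verts G)))"

lemma ssat_le_iff:
  "ssat r k \<le> enat n \<longleftrightarrow> (\<exists>G. semisaturated r k G \<and> card (verts G) \<le> n)"
proof
  assume le: "ssat r k \<le> enat n"
  let ?A = "(\<lambda>G. enat (card (verts G))) ` {G. semisaturated r k G}"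
  have "?A \<noteq> {}"
  proof
    assume "?A = {}"
    then have "ssat r k = \<infinity>"
      unfolding ssat_def by (metis Inf_empty top_enat_def)
    with le show False by simp
  qed
  then have "Inf ?A \<in> ?A"
    by (metis wellorder_InfI ex_in_conv)
  then obtain G where "semisaturated r k G" "ssat r k = enat (card (verts G))"
    by (auto simp: ssat_def)
  with le show "\<exists>G. semisaturated r k G \<and> card (verts G) \<le> n"
    by auto
next
  assume "\<exists>G. semisaturated r k G \<and> card (verts G) \<le> n"
  then obtain G where G: "semisaturated r k G" "card (verts G) \<le> n" by blast
  then have "ssat r k \<le> enat (card (verts G))"
    unfolding ssat_def by (intro INF_lower) simp
  then show "ssat r k \<le> enat n"
    using G(2) by (meson enat_ord_simps(1) order_trans)
qed

end

theory Submission
  imports Defs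
begin

text \<open>A new vertex \<open>v\<close> splits the old vertices into \<open>r\<close> classes by the color of the edge to \<open>v\<close>,
  so it suffices to color a complete graph such that every \<open>r\<close>-coloring of its vertices has a color
  \<open>i\<close> whose class contains a clique of size \<open>k - 1\<close> of edge color \<open>i\<close>.  Take an integer grid and
  give edge color \<open>i\<close> to the pairs of points on a common line of the \<open>i\<close>-th of \<open>r\<close> different slopes.
  On a grid of width \<open>2kr\<close> and height \<open>2kr\<^sup>2\<close> there are so few of these lines that, by pigeonhole,
  some line of the \<open>i\<close>-th slope contains \<open>k\<close> points of color \<open>i\<close>.\<close>

text \<open>The number \<open>p\<close> encodes the grid point with coordinates \<open>x = p mod a\<close> and \<open>y = p div a\<close>.
  Slopes are negative so that the lines \<open>y + (i - 1) * x = const\<close> stay within the naturals.\<close>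

definition intercept :: "nat \<Rightarrow> nat \<Rightarrow> nat \<Rightarrow> nat" where
  "intercept a i p = p div a + (i - 1) * (p mod a)"

text \<open>Two distinct points share a line of at most one slope, so \<open>SOME\<close> has a
  single candidate on edges. The default 1 keeps pairs on no common line within the palette.\<close>

definition grid_color :: "nat \<Rightarrow> nat \<Rightarrow> nat set \<Rightarrow> nat" where
  "grid_color a r e =
     (if \<exists>i\<in>{1..r}. \<exists>c. \<forall>p\<in>e. intercept a i p = c
      then SOME i. i \<in> {1..r} \<and> (\<exists>c. \<forall>p\<in>e. intercept a i p = c) else 1)"

definition grid_graph :: "nat \<Rightarrow> nat \<Rightarrow> nat \<Rightarrow> cgraph" where
  "grid_graph a b r = \<lparr>verts = {..<a * b}, color = grid_color a r\<rparr>"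

text \<open>Lines of different slopes meet at most once: subtracting the two intercepts leaves
  \<open>(j - i) * x\<close>, which fixes \<open>x\<close> and then \<open>y\<close>. With
  \<open>1 \<le> i\<close> the truncated \<open>i - 1\<close> still separates the slopes.\<close>

lemma intercept_inj:
  assumes "intercept a i p = intercept a i q" "intercept a j p = intercept a j q"
    and "1 \<le> i" "i < j"
  shows "p = q"
proof -
  define d where "d = j - i"
  have d: "d > 0" "j - 1 = (i - 1) + d"
    using assms by (auto simp: d_def)
  have "d * (p mod a) = d * (q mod a)"
    using assms(1,2) unfolding intercept_def d(2) add_mult_distrib by linarith
  then have "p mod a = q mod a"
    using d(1) by simp
  moreover from this have "p div a = q div a"
    using assms(1) by (simp add: intercept_def)
  ultimately show ?thesis
    by (metis div_mult_mod_eq)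
qed

lemma grid_color_mem:
  assumes "1 \<le> r"
  shows "grid_color a r e \<in> {1..r}"
proof (cases "\<exists>i\<in>{1..r}. \<exists>c. \<forall>p\<in>e. intercept a i p = c")
  case True
  then have "\<exists>i. i \<in> {1..r} \<and> (\<exists>c. \<forall>p\<in>e. intercept a i p = c)"
    by blast
  from someI_ex[OF this] show ?thesis
    using True by (simp add: grid_color_def)
next
  case False
  then show ?thesis
    using assms by (auto simp: grid_color_def)
qed

lemma grid_color_eq:
  assumes "i \<in> {1..r}" "p \<noteq> q" "intercept a i p = intercept a i q"
  shows "grid_color a r {p, q} = i"
proof -
  let ?P = "\<lambda>j. j \<in> {1..r} \<and> (\<exists>c. \<forall>x\<in>{p, q}. intercept a j x = c)"
  have P: "?P i"
    using assms by auto
  have "j = i" if "?P j" for j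
  proof (rule ccontr)
    assume "j \<noteq> i"
    moreover have "intercept a j p = intercept a j q"
      using that by auto
    ultimately show False
      using intercept_inj[of a i p q j] intercept_inj[of a j p q i] that assms
      by (metis atLeastAtMost_iff linorder_neqE_nat)
  qed
  with P have "(SOME j. ?P j) = i"
    by (intro some_equality) blast+
  moreover have "\<exists>i\<in>{1..r}. \<exists>c. \<forall>x\<in>{p, q}. intercept a i x = c"
    using P by blast
  ultimately show ?thesis
    by (simp add: grid_color_def)
qed

text \<open>Reduces an extension by any number of vertices to a single new vertex over an unchanged
  \<open>G\<close>.\<close>

lemma extends_new_vertex:
  assumes "extends r G' G"
  obtains v where "v \<in> verts G'" "v \<notin> verts G" "verts G \<subseteq> verts G'"
    "\<forall>e\<in>edges G. color G' e = color G e"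
proof -
  have "(\<exists>v. v \<in> verts G' \<and> v \<notin> verts G) \<and> verts G \<subseteq> verts G' \<and>
    (\<forall>e\<in>edges G. color G' e = color G e)"
    using assms unfolding extends_def
  proof (induction rule: tranclp_induct)
    case (base H)
    then show ?case
      unfolding adds_vertex_def by auto
  next
    case (step H H')
    then have "edges G \<subseteq> edges H"
      by (auto simp: edges_def nsets_def)
    with step show ?case
      unfolding adds_vertex_def by auto
  qed
  then show thesis
    using that by blast
qed

text \<open>Take \<open>\<chi> p\<close> to be the color of the edge from the new vertex
  \<open>v\<close> to \<open>p\<close>. Adding \<open>v\<close> to \<open>S\<close> then keeps the
  clique monochromatic, and \<open>v\<close> makes it new.\<close>

lemma semisaturatedI:
  assumes G: "G \<in> colored_complete_graphs r" and "k \<ge> 1"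
    and cliques: "\<And>\<chi>. \<chi> ` verts G \<subseteq> {1..r} \<Longrightarrow>
      \<exists>i S. S \<subseteq> verts G \<and> finite S \<and> card S = k - 1 \<and> (\<forall>p\<in>S. \<chi> p = i) \<and>
        (\<forall>e\<in>nsets S 2. color G e = i)"
  shows "semisaturated r k G"
  unfolding semisaturated_def
proof (intro conjI ballI impI G)
  fix G' assume G': "G' \<in> colored_complete_graphs r" and "extends r G' G"
  then obtain v where v: "v \<in> verts G'" "v \<notin> verts G" "verts G \<subseteq> verts G'"
    and eq: "\<forall>e\<in>edges G. color G' e = color G e"
    using extends_new_vertex by blast
  have "(\<lambda>p. color G' {v, p}) ` verts G \<subseteq> {1..r}"
  proof
    fix c assume "c \<in> (\<lambda>p. color G' {v, p}) ` verts G"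
    then obtain p where p: "p \<in> verts G" "c = color G' {v, p}"
      by blast
    then have "{v, p} \<in> edges G'"
      using v by (auto simp: edges_def nsets_def card_insert_if)
    then show "c \<in> {1..r}"
      using G' p by (auto simp: colored_complete_graphs_def)
  qed
  from cliques[OF this] obtain i S where
    S: "S \<subseteq> verts G" "finite S" "card S = k - 1" "\<forall>p\<in>S. color G' {v, p} = i"
    and mono: "\<forall>e\<in>nsets S 2. color G e = i"
    by blast
  have "color G' e = i" if e: "e \<in> nsets (insert v S) 2" for e
  proof (cases "v \<in> e")
    case True
    obtain x y where "e = {x, y}" "x \<noteq> y"
      using e by (auto simp: nsets_def card_2_iff)
    with True obtain p where "e = {v, p}" "p \<noteq> v"
      by (metis insertE insert_commute singletonD)
    then show ?thesis
      using e S(4) by (auto simp: nsets_def)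
  next
    case False
    then have "e \<in> nsets S 2"
      using e by (auto simp: nsets_def)
    moreover from this have "e \<in> edges G"
      using S(1) by (auto simp: nsets_def edges_def)
    ultimately show ?thesis
      using eq mono by simp
  qed
  moreover have "insert v S \<in> nsets (verts G') k"
  proof -
    have "v \<notin> S"
      using S(1) v(2) by blast
    then show ?thesis
      using S v \<open>k \<ge> 1\<close> by (auto simp: nsets_def)
  qed
  ultimately have "mono_clique k G' (insert v S)"
    by (auto simp: mono_clique_def)
  then show "\<exists>S. mono_clique k G' S \<and> \<not> S \<subseteq> verts G"
    using v(2) by blast
qed

lemma semisaturated_grid_graph:
  assumes "k \<ge> 1" "r \<ge> 1" and ab: "r * (b + a * r) * (k - 1) < a * b"
  shows "semisaturated r k (grid_graph a b r)"
proof (rule semisaturatedI)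
  show "grid_graph a b r \<in> colored_complete_graphs r"
    using grid_color_mem[OF \<open>r \<ge> 1\<close>]
    by (simp add: grid_graph_def colored_complete_graphs_def image_subset_iff)
  show "k \<ge> 1" by fact
  fix \<chi> assume chi: "\<chi> ` verts (grid_graph a b r) \<subseteq> {1..r}"
  \<comment> \<open>\<open>?f\<close> sends \<open>p\<close> to the line through \<open>p\<close>
    whose slope is given by the color of \<open>p\<close>. Intercepts stay below
    \<open>b + a * r\<close> because \<open>y < b\<close> and
    \<open>(i - 1) * x \<le> a * r\<close>.\<close>
  let ?f = "\<lambda>p. (\<chi> p, intercept a (\<chi> p) p)"
  let ?B = "{1..r} \<times> {..<b + a * r}"
  have "?f \<in> {..<a * b} \<rightarrow> ?B"
  proof
    fix p assume p: "p \<in> {..<a * b}"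
    then have "a > 0"
      by (cases a) auto
    have i: "\<chi> p \<in> {1..r}"
      using chi p by (auto simp: grid_graph_def)
    have "p div a < b"
      using p by (simp add: less_mult_imp_div_less mult.commute)
    moreover have "(\<chi> p - 1) * (p mod a) \<le> r * a"
      using i \<open>a > 0\<close> by (intro mult_le_mono) (auto simp: less_imp_le)
    ultimately show "?f p \<in> ?B"
      using i by (simp add: intercept_def mult.commute[of a r] add_less_le_mono)
  qed
  moreover have "?B \<noteq> {}"
    using \<open>r \<ge> 1\<close> ab by (cases b) auto
  ultimately obtain i c where i: "i \<in> {1..r}"
    and fibre: "card {..<a * b} \<le> card (?f -` {(i, c)} \<inter> {..<a * b}) * card ?B"
    using pigeonhole_card[of ?f "{..<a * b}" ?B] by blast
  have "(k - 1) * card ?B < card {..<a * b}"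
    using ab by (simp add: card_cartesian_product mult.commute)
  \<comment> \<open>The strict inequality even gives \<open>k\<close> points on the line; the clique
    needs only \<open>k - 1\<close>, as the new vertex supplies the last one.\<close>
  from less_le_trans[OF this fibre] have big: "k - 1 \<le> card (?f -` {(i, c)} \<inter> {..<a * b})"
    unfolding mult_less_cancel2 by (rule less_imp_le[OF conjunct2])
  obtain S where S: "S \<subseteq> ?f -` {(i, c)} \<inter> {..<a * b}" "card S = k - 1" "finite S"
    using obtain_subset_with_card_n[OF big] by metis
  then have line: "\<chi> p = i" "intercept a i p = c" if "p \<in> S" for p
    using that by auto
  have "grid_color a r e = i" if e: "e \<in> nsets S 2" for e
  proof -
    obtain p q where "e = {p, q}" "p \<noteq> q" "p \<in> S" "q \<in> S"
      using e by (auto simp: nsets_def card_2_iff)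
    then show ?thesis
      using grid_color_eq[OF i] line by simp
  qed
  then show "\<exists>i S. S \<subseteq> verts (grid_graph a b r) \<and> finite S \<and> card S = k - 1 \<and>
      (\<forall>p\<in>S. \<chi> p = i) \<and> (\<forall>e\<in>nsets S 2. color (grid_graph a b r) e = i)"
    using S line by (intro exI[of _ i] exI[of _ S]) (auto simp: grid_graph_def)
qed

theorem theorem1p5:
  fixes k r :: nat
  assumes "k \<ge> 2" and "r \<ge> 3"
  shows "ssat r k \<le> enat (8 * k ^ 3 * r ^ 3)"
proof -
  \<comment> \<open>With \<open>?b = ?a * r\<close> both terms of the intercept bound are equal, so
    there are at most \<open>2 * r * ?b\<close> pairs of slope and intercept;
    \<open>?a = 2 * k * r\<close> then gives \<open>k\<close> points per pair on average.\<close>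
  let ?a = "2 * k * r" and ?b = "2 * k * r ^ 2"
  have prod: "?a * ?b = 4 * k ^ 2 * r ^ 3"
    by (simp add: power2_eq_square power3_eq_cube)
  have "r * (?b + ?a * r) * (k - 1) = 4 * k * r ^ 3 * (k - 1)"
    by (simp add: power2_eq_square power3_eq_cube algebra_simps)
  also have "\<dots> < 4 * k * r ^ 3 * k"
    using assms by (intro mult_strict_left_mono) auto
  also have "\<dots> = ?a * ?b"
    unfolding prod by (simp add: power2_eq_square)
  finally have "semisaturated r k (grid_graph ?a ?b r)"
    using assms by (intro semisaturated_grid_graph) auto
  moreover have "card (verts (grid_graph ?a ?b r)) \<le> 8 * k ^ 3 * r ^ 3"
  proof -
    have "4 * k ^ 2 * r ^ 3 \<le> 8 * k ^ 3 * r ^ 3"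
      using assms by (intro mult_le_mono power_increasing) auto
    then show ?thesis
      by (simp only: grid_graph_def cgraph.simps card_lessThan prod)
  qed
  ultimately show ?thesis
    unfolding ssat_le_iff by blast
qed

end
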